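(* Let $\{a(n)\}_{n\geq 0}$ be Stern's diatomic sequence, defined by $a(0)=0$, $a(1)=1$, and for $n\geq 1$ by $a(2n)=a(n)$ and $a(2n+1)=a(n)+a(n+1)$. Let $\varphi=(1+\sqrt{5})/2$. Then $$\limsup_{n\to\infty}\frac{a(n)}{n^{\log_2\varphi}}=\frac{\varphi}{\sqrt{5}}\left(\frac{3}{2}\right)^{\log_2\varphi}=\frac{\varphi^{\log_2 3}}{\sqrt{5}}.$$
   Context: $\log_2$ denotes the base-$2$ logarithm. *)

theory Defs
  imports Complex_Main "HOL-Library.Extended_Real" "HOL-Library.Liminf_Limsup"
begin

text \<open>Stern's diatomic sequence. The equations \<open>stern_0\<close>, \<open>stern_1\<close>, \<open>stern_double\<close> and
  \<open>stern_double_plus_1\<close> below are the usual recursive characterization.\<close>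

function stern :: "nat \<Rightarrow> nat" where
  "stern n =
    (if n \<le> 1 then n
     else if even n then stern (n div 2)
     else stern (n div 2) + stern (n div 2 + 1))"
  by pat_completeness auto
termination by (relation "measure id") (auto elim!: oddE)

declare stern.simps [simp del]

lemma stern_0: "stern 0 = 0"
  by (simp add: stern.simps)

lemma stern_1: "stern 1 = 1"
  by (simp add: stern.simps)

lemma stern_double: "n \<ge> 1 \<Longrightarrow> stern (2 * n) = stern n"
  by (subst stern.simps) auto

lemma stern_double_plus_1: "n \<ge> 1 \<Longrightarrow> stern (2 * n + 1) = stern n + stern (n + 1)"
  by (subst stern.simps) auto

definition golden_ratio :: real where
  "golden_ratio = (1 + sqrt 5) / 2"

end

(* The maxima of Stern's sequence between consecutive powers of 2 are attained at the
   Jacobsthal numbers J k = (2^k - (-1)^k) / 3, where stern (J k) = fib k. The points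
   (2^k / 3, phi^k / sqrt 5) approximate (J k, fib k) and lie on the concave graph of
   C * x powr log 2 phi with C = phi powr log 2 3 / sqrt 5. It therefore suffices to show that stern
   stays below each chord through two consecutive such points, up to a bounded error.
   The deviation of stern n from the k-th chord is bounded by induction on k, separately for
   n even, n = 1 and n = 3 modulo 4, using stern (4m+1) = stern m + stern (2m+1) and
   stern (4m+3) = stern (2m+1) + stern (m+1). Distinguishing the residues is necessary: an error
   accumulated uniformly would change the constant C. *)
theory Submission
  imports Defs "HOL-Analysis.Analysis"
begin

section \<open>Arithmetic of the golden ratio\<close>

abbreviation (input) golden_ratio_phi :: real ("\<phi>") where "\<phi> \<equiv> golden_ratio"

lemma golden_ratio_sq: "\<phi> * \<phi> = \<phi> + 1"
  by (simp add: golden_ratio_def field_simps)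

lemma golden_ratio_gt_1: "\<phi> > 1"
  by (simp add: golden_ratio_def)

lemma sqrt5_bounds: "2.236 < sqrt 5" "sqrt 5 < 2.237"
  by (rule real_less_rsqrt, simp add: power2_eq_square, rule real_less_lsqrt, auto simp: power2_eq_square)

lemma golden_ratio_bounds: "1.618 < \<phi>" "\<phi> < 1.6185"
  using sqrt5_bounds by (simp_all add: golden_ratio_def)

lemma sqrt5_eq: "sqrt 5 = 2 * \<phi> - 1"
  by (simp add: golden_ratio_def field_simps)

text \<open>\<open>slope k\<close> is the slope of the chord of \<open>C x\<^sup>\<alpha>\<close> between \<open>2\<^sup>k/3\<close> and \<open>2\<^sup>k\<^sup>+\<^sup>1/3\<close>. For
  \<open>k \<ge> 2\<close>, \<open>bound1 k\<close> and \<open>bound3 k\<close> equal \<open>fib i - slope k * J i\<close>, where \<open>i\<close> is the even, respectively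
  odd, element of \<open>{k, k + 1}\<close>. They are thus the least possible
  bounds for \<open>stern n - slope k * n\<close> over \<open>n\<close> congruent to 1, respectively 3, modulo 4.\<close>

definition slope :: "nat \<Rightarrow> real" where
  "slope k = 3 * (\<phi> - 1) * (\<phi> / 2) ^ k / sqrt 5"

definition bound1 :: "nat \<Rightarrow> real" where
  "bound1 k = ((\<phi> - 1)\<^sup>2 * \<phi> ^ k + (\<phi> - 1) * (\<phi> / 2) ^ k - ((\<phi> - 1)\<^sup>2) ^ ((k + 1) div 2)) / sqrt 5"

definition bound3 :: "nat \<Rightarrow> real" where
  "bound3 k = ((\<phi> - 1)\<^sup>2 * \<phi> ^ k - (\<phi> - 1) * (\<phi> / 2) ^ k + (\<phi> - 1) * ((\<phi> - 1)\<^sup>2) ^ (k div 2)) / sqrt 5"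

section \<open>Recurrences and first values of the slopes and constants\<close>

text \<open>Mirrors the split of \<open>4 * m + 1\<close> into \<open>m\<close> and
  \<open>2 * m + 1\<close>: in \<open>slope k * m + slope (k + 1) * (2 * m + 1) - slope (k + 2) * (4
  * m + 1)\<close> the multiples of \<open>m\<close> cancel by \<open>slope_rec\<close>, and exactly
  these slope terms remain.\<close>

lemma bound1_rec: "bound1 (k + 2) = bound1 k + bound3 (k + 1) + slope (k + 1) - slope (k + 2)"
proof -
  have y: "((\<phi> - 1)\<^sup>2) ^ ((k + 2 + 1) div 2) = ((\<phi> - 1)\<^sup>2) ^ ((k + 1) div 2) * (\<phi> - 1)\<^sup>2"
    by simp
  \<comment> \<open>With the powers replaced by free variables and \<open>w\<close> standing for
    \<open>\<phi> / 2\<close>, a polynomial identity modulo \<open>golden_ratio_sq\<close> and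
    \<open>2 * w = \<phi>\<close> remains.\<close>
  have "(\<phi> - 1)\<^sup>2 * (X * \<phi>\<^sup>2) + (\<phi> - 1) * (Y * w\<^sup>2) - Z * (\<phi> - 1)\<^sup>2 =
    ((\<phi> - 1)\<^sup>2 * X + (\<phi> - 1) * Y - Z) +
    ((\<phi> - 1)\<^sup>2 * (X * \<phi>) - (\<phi> - 1) * (Y * w) + (\<phi> - 1) * Z)
    + 3 * (\<phi> - 1) * (Y * w) - 3 * (\<phi> - 1) * (Y * w\<^sup>2)"
    if "2 * w = \<phi>" for X Y Z w :: real
    using golden_ratio_sq that by algebra
  from this[of "\<phi> / 2"] show ?thesis
    unfolding bound1_def bound3_def slope_def y power_add add_divide_distrib[symmetric] diff_divide_distrib[symmetric]
    by (simp only: power_one_right)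
qed

text \<open>The same for the split of \<open>4 * m + 3\<close> into \<open>2 * m + 1\<close> and
  \<open>m + 1\<close>.\<close>

lemma bound3_rec: "bound3 (k + 2) = bound3 k + bound1 (k + 1) + slope k + slope (k + 1) - 3 * slope (k + 2)"
proof -
  have y: "((\<phi> - 1)\<^sup>2) ^ ((k + 2) div 2) = ((\<phi> - 1)\<^sup>2) ^ (k div 2) * (\<phi> - 1)\<^sup>2"
    "((\<phi> - 1)\<^sup>2) ^ ((k + 1 + 1) div 2) = ((\<phi> - 1)\<^sup>2) ^ (k div 2) * (\<phi> - 1)\<^sup>2"
    by simp_all
  have "(\<phi> - 1)\<^sup>2 * (X * \<phi>\<^sup>2) - (\<phi> - 1) * (Y * w\<^sup>2) + (\<phi> - 1) * (Z * (\<phi> - 1)\<^sup>2) =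
    ((\<phi> - 1)\<^sup>2 * X - (\<phi> - 1) * Y + (\<phi> - 1) * Z) +
    ((\<phi> - 1)\<^sup>2 * (X * \<phi>) + (\<phi> - 1) * (Y * w) - Z * (\<phi> - 1)\<^sup>2)
    + 3 * (\<phi> - 1) * Y + 3 * (\<phi> - 1) * (Y * w) - 3 * (3 * (\<phi> - 1) * (Y * w\<^sup>2))"
    if "2 * w = \<phi>" for X Y Z w :: real
    using golden_ratio_sq that by algebra
  from this[of "\<phi> / 2"] show ?thesis
    unfolding bound1_def bound3_def slope_def y power_add times_divide_eq_right
      add_divide_distrib[symmetric] diff_divide_distrib[symmetric]
    by (simp only: power_one_right) simp
qed

text \<open>\<open>\<phi> / 2\<close> is a root of \<open>4 * x^2 = 2 * x + 1\<close>.\<close>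

lemma slope_rec: "slope k + 2 * slope (k + 1) = 4 * slope (k + 2)"
proof -
  have "3 * (\<phi> - 1) * Y + 2 * (3 * (\<phi> - 1) * (Y * w)) = 4 * (3 * (\<phi> - 1) * (Y * w\<^sup>2))"
    if "2 * w = \<phi>" for Y w :: real
    using golden_ratio_sq that by algebra
  from this[of "\<phi> / 2"] show ?thesis
    unfolding slope_def power_add times_divide_eq_right add_divide_distrib[symmetric]
    by (simp only: power_one_right) simp
qed

lemma slope_Suc: "slope (Suc k) = \<phi> / 2 * slope k"
  by (simp add: slope_def)

lemma slope_pos: "slope k > 0"
  using golden_ratio_gt_1 by (simp add: slope_def)

lemma golden_ratio_powers: "\<phi> ^ 2 = \<phi> + 1" "\<phi> ^ 3 = 2 * \<phi> + 1" "\<phi> ^ 4 = 3 * \<phi> + 2" "\<phi> ^ 5 = 5 * \<phi> + 3"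
  "(\<phi> - 1)\<^sup>2 = 2 - \<phi>" "(2 - \<phi>)\<^sup>2 = 5 - 3 * \<phi>" "(2 - \<phi>) ^ 3 = 13 - 8 * \<phi>"
  using golden_ratio_sq by algebra+

lemma slope_values:
  "slope 2 = 3 * (5 + sqrt 5) / 40" "slope 3 = 3 * (5 + 3 * sqrt 5) / 80"
  "slope 4 = 3 * (5 + 2 * sqrt 5) / 80" "slope 5 = 3 * (15 + 7 * sqrt 5) / 320"
proof -
  have [simp]: "sqrt 5 * (sqrt 5 * x) = 5 * x" "sqrt 5 * sqrt 5 = 5" for x by simp_all
  show "slope 2 = 3 * (5 + sqrt 5) / 40" "slope 3 = 3 * (5 + 3 * sqrt 5) / 80"
  "slope 4 = 3 * (5 + 2 * sqrt 5) / 80" "slope 5 = 3 * (15 + 7 * sqrt 5) / 320"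
    by (simp_all add: slope_def power_divide golden_ratio_powers)
     (simp_all add: golden_ratio_def field_simps)
qed

lemma slope_bounds:
  "slope 2 > 0.5427" "slope 2 < 0.5429" "slope 3 > 0.439" "slope 3 < 0.4392"
  "slope 4 > 0.3551" "slope 4 < 0.3553" "slope 5 > 0.2873" "slope 5 < 0.2875"
  unfolding slope_values using sqrt5_bounds by (simp_all add: field_simps)

lemma bound_values:
  "bound1 2 = 1 - slope 2" "bound1 3 = 3 - 5 * slope 3" "bound1 4 = 3 - 5 * slope 4" "bound1 5 = 8 - 21 * slope 5"
  "bound3 2 = 2 - 3 * slope 2" "bound3 3 = 2 - 3 * slope 3" "bound3 4 = 5 - 11 * slope 4" "bound3 5 = 5 - 11 * slope 5"
proof -
  have [simp]: "sqrt 5 * (sqrt 5 * x) = 5 * x" "sqrt 5 * sqrt 5 = 5" for x by simp_all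
  show "bound1 2 = 1 - slope 2" "bound1 3 = 3 - 5 * slope 3" "bound1 4 = 3 - 5 * slope 4" "bound1 5 = 8 - 21 * slope 5"
  "bound3 2 = 2 - 3 * slope 2" "bound3 3 = 2 - 3 * slope 3" "bound3 4 = 5 - 11 * slope 4" "bound3 5 = 5 - 11 * slope 5"
    unfolding slope_values
    by (simp_all add: bound1_def bound3_def power_divide golden_ratio_powers)
     (simp_all add: golden_ratio_def field_simps)
qed

section \<open>Inequalities between the constants\<close>

text \<open>Up to the factor \<open>sqrt 5\<close>, the difference is twice
  \<open>(\<phi> - 1) * (\<phi> / 2) ^ k\<close> minus two terms that are each at most
  \<open>(\<phi> - 1) ^ k\<close>. The former dominates from \<open>k = 2\<close> on.\<close>

lemma bound3_le_bound1: "bound3 k \<le> bound1 k" if "k \<ge> 2"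
proof -
  have h: "0 < \<phi> - 1" "\<phi> - 1 < 1" "\<phi> - 1 \<le> \<phi> / 2"
    using golden_ratio_bounds by auto
  have "((\<phi> - 1)\<^sup>2) ^ ((k + 1) div 2) \<le> (\<phi> - 1) ^ k"
    unfolding power_mult[symmetric] using h by (intro power_decreasing) auto
  moreover have "(\<phi> - 1) * ((\<phi> - 1)\<^sup>2) ^ (k div 2) \<le> (\<phi> - 1) ^ k"
    unfolding power_mult[symmetric] power_Suc[symmetric] using h by (intro power_decreasing) auto
  moreover have "(\<phi> - 1) ^ k \<le> (\<phi> - 1) * (\<phi> / 2) ^ k"
    using that
  proof (induction k rule: dec_induct)
    case base
    have "\<phi> - 1 \<le> \<phi>\<^sup>2 / 4"
      using golden_ratio_bounds golden_ratio_powers(1) by simp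
    thus ?case using h by (simp add: power2_eq_square)
  next
    case (step n)
    have "(\<phi> - 1) * (\<phi> - 1) ^ n \<le> (\<phi> / 2) * ((\<phi> - 1) * (\<phi> / 2) ^ n)"
      using h step by (intro mult_mono) auto
    thus ?case by (simp add: mult_ac)
  qed
  ultimately show ?thesis
    unfolding bound1_def bound3_def by (intro divide_right_mono) auto
qed

lemma bound_gap_le: "bound1 k - bound3 k \<le> 2 / 3 * slope k"
proof -
  have "bound1 k - bound3 k = 2 / 3 * slope k - (((\<phi> - 1)\<^sup>2) ^ ((k + 1) div 2) + (\<phi> - 1) * ((\<phi> - 1)\<^sup>2) ^ (k div 2)) / sqrt 5"
    by (simp add: bound1_def bound3_def slope_def add_divide_distrib diff_divide_distrib algebra_simps)
  thus ?thesis using golden_ratio_gt_1 by simp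
qed

lemma slope_Suc_bounds: "4 / 5 * slope k \<le> slope (Suc k)" "slope (Suc k) \<le> 82 / 100 * slope k"
  unfolding slope_Suc using slope_pos[of k] golden_ratio_bounds
  by (intro mult_right_mono; simp)+

lemma slope_antimono: "i \<le> j \<Longrightarrow> slope j \<le> slope i"
proof (induction rule: dec_induct)
  case (step n)
  thus ?case using slope_Suc_bounds(2)[of n] slope_pos[of n] by linarith
qed simp

text \<open>Adding the two recurrences cancels all slopes, so \<open>bound1 + bound3\<close> obeys
  the Fibonacci recurrence and stays above its first values; \<open>bound1\<close> is at least half
  of it.\<close>

lemma bound1_lower_bound: "bound1 k \<ge> 7 / 10" if "k \<ge> 3"
proof -
  have rec: "bound1 (k + 2) + bound3 (k + 2) = (bound1 k + bound3 k) + (bound1 (k + 1) + bound3 (k + 1))" for k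
    using bound1_rec[of k] bound3_rec[of k] slope_rec[of k] by linarith
  have "bound1 (j + 3) + bound3 (j + 3) \<ge> 14 / 10 \<and> bound1 (j + 4) + bound3 (j + 4) \<ge> 14 / 10" for j
  proof (induction j)
    case 0
    show ?case using slope_bounds by (simp add: bound_values)
  next
    case (Suc j)
    thus ?case using rec[of "j + 3"] by (simp add: eval_nat_numeral)
  qed
  from this[of "k - 3"] bound3_le_bound1[of k] that show ?thesis by simp
qed

text \<open>This is what the induction step needs at arguments \<open>16 * j + 3\<close>. The gap is
  at most a multiple of the decaying slope, whereas by \<open>bound1_rec\<close> the increment is at
  least \<open>bound1 (k - 1)\<close> less such a gap.\<close>

lemma bound_gap_le_increment: "2 * (bound1 (k + 2) - bound3 (k + 2)) \<le> bound1 (k + 1) - bound1 k" if k: "k \<ge> 2"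
proof -
  consider "k = 2" | "k = 3" | "k \<ge> 4" using k by linarith
  thus ?thesis
  proof cases
    case 3
    define j where "j = k - 1"
    have j: "k = j + 1" "j \<ge> 3" using 3 by (auto simp: j_def)
    have "slope k \<le> 356 / 1000"
      using slope_antimono[OF 3] slope_bounds by simp
    thus ?thesis
      using bound1_rec[of j] bound_gap_le[of k] bound_gap_le[of "k + 2"] slope_Suc_bounds[of k] slope_Suc_bounds[of "k + 1"]
        bound1_lower_bound[OF j(2)] slope_pos[of k]
      by (simp add: j(1))
  qed (use slope_bounds in \<open>simp_all add: bound_values\<close>)
qed

lemma bound1_le_bound3: "bound1 (k + 1) \<le> bound3 (k + 2)" if "k \<ge> 2"
proof (cases "k = 2")
  case True
  thus ?thesis using slope_bounds by (simp add: bound_values)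
next
  case False
  hence "k \<ge> 3" using that by simp
  have "slope (k + 1) \<le> 356 / 1000"
    using slope_antimono[of 4 "k + 1"] \<open>k \<ge> 3\<close> slope_bounds by simp
  thus ?thesis
    using bound1_rec[of k] bound_gap_le[of "k + 1"] bound_gap_le[of "k + 2"] slope_Suc_bounds[of "k + 1"]
      bound1_lower_bound[OF \<open>k \<ge> 3\<close>] slope_pos[of "k + 1"]
    by simp
qed

section \<open>Bounds by residue class and the induction step\<close>

lemma stern_4m1: "stern (4 * m + 1) = stern m + stern (2 * m + 1)"
  using stern_double[of m] stern_double_plus_1[of "2 * m"]
  by (cases "m = 0") (auto simp: stern_0 stern_1)

lemma stern_4m3: "stern (4 * m + 3) = stern (2 * m + 1) + stern (m + 1)"
  using stern_double[of "m + 1"] stern_double_plus_1[of "2 * m + 1"]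
  by (simp add: algebra_simps eval_nat_numeral)

lemma stern_even: "stern (2 * m) = stern m"
  by (cases "m = 0") (auto simp: stern_double)

definition stern_bounds :: "nat \<Rightarrow> bool" where
  "stern_bounds k \<longleftrightarrow>
    (\<forall>m. real (stern (2 * m)) \<le> bound1 k + slope (k + 1) * real (2 * m)) \<and>
    (\<forall>m. real (stern (4 * m + 1)) \<le> bound1 (k + 1) + slope (k + 1) * real (4 * m + 1)) \<and>
    (\<forall>m. real (stern (4 * m + 3)) \<le> bound3 (k + 1) + slope (k + 1) * real (4 * m + 3))"

lemma nat_mod4_cases:
  obtains m :: nat where "n = 2 * m" | m where "n = 4 * m + 1" | m where "n = 4 * m + 3"
proof -
  have "n = 2 * (n div 2) \<or> n = 4 * (n div 4) + 1 \<or> n = 4 * (n div 4) + 3" by presburger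
  thus ?thesis using that by blast
qed

text \<open>\<open>bound1 (k + 1)\<close> is the largest of the three constants: the increment of
  \<open>bound1\<close> dominates a nonnegative gap.\<close>

lemma stern_bounds_imp:
  assumes "stern_bounds k" "k \<ge> 2"
  shows "real (stern n) \<le> bound1 (k + 1) + slope (k + 1) * real n"
proof -
  have "bound1 k \<le> bound1 (k + 1)" "bound3 (k + 1) \<le> bound1 (k + 1)"
    using bound_gap_le_increment[of k] bound3_le_bound1[of "k + 2"] bound3_le_bound1[of "k + 1"] assms by auto
  thus ?thesis
    using assms(1) unfolding stern_bounds_def
    by (cases n rule: nat_mod4_cases) (smt (verit))+
qed

text \<open>Lines with slope indices \<open>k + 2\<close> and \<open>k + 3\<close> add up to one of
  index \<open>k + 4\<close>, so each case reduces to comparing constants. For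
  \<open>4 * m + 1\<close> with \<open>m\<close> congruent to 1, and \<open>4 * m + 3\<close> with
  \<open>m\<close> congruent to 2 modulo 4, they agree exactly; elsewhere \<open>gaps\<close>
  supplies the slack.\<close>

lemma stern_bounds_step:
  assumes "stern_bounds k" "stern_bounds (k + 1)" "stern_bounds (k + 2)" "k \<ge> 2"
  shows "stern_bounds (k + 3)"
proof -
  have b1: "real (stern (2 * m)) \<le> bound1 k + 2 * (slope (k + 1) * m)" for m
    using assms(1) by (simp add: stern_bounds_def algebra_simps)
  have b2: "real (stern (2 * m)) \<le> bound1 (k + 1) + 2 * (slope (k + 2) * m)"
    "real (stern (4 * m + 1)) \<le> bound1 (k + 2) + 4 * (slope (k + 2) * m) + slope (k + 2)"
    "real (stern (4 * m + 3)) \<le> bound3 (k + 2) + 4 * (slope (k + 2) * m) + 3 * slope (k + 2)" for m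
    using assms(2) by (simp_all add: stern_bounds_def algebra_simps eval_nat_numeral)
  have b3: "real (stern (4 * m + 1)) \<le> bound1 (k + 3) + 4 * (slope (k + 3) * m) + slope (k + 3)"
    "real (stern (4 * m + 3)) \<le> bound3 (k + 3) + 4 * (slope (k + 3) * m) + 3 * slope (k + 3)" for m
    using assms(3) by (simp_all add: stern_bounds_def algebra_simps eval_nat_numeral)
  have r: "slope (k + 2) * m + 2 * (slope (k + 3) * m) = 4 * (slope (k + 4) * m)"
    "slope (k + 1) * m + 2 * (slope (k + 2) * m) = 4 * (slope (k + 3) * m)" for m :: real
    using slope_rec[of "k + 2"] slope_rec[of "k + 1"]
    by (simp_all add: eval_nat_numeral flip: distrib_right mult.assoc)
  note r1 = r[of 1, unfolded mult_1_right]
  have rec: "bound1 (k + 4) = bound1 (k + 2) + bound3 (k + 3) + slope (k + 3) - slope (k + 4)"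
    "bound3 (k + 4) = bound3 (k + 2) + bound1 (k + 3) + slope (k + 2) + slope (k + 3) - 3 * slope (k + 4)"
    "bound1 (k + 3) = bound1 (k + 1) + bound3 (k + 2) + slope (k + 2) - slope (k + 3)"
    using bound1_rec[of "k + 2"] bound1_rec[of "k + 1"] bound3_rec[of "k + 2"] by (simp_all add: eval_nat_numeral)
  have gaps: "bound3 (k + 2) \<le> bound1 (k + 2)" "bound3 (k + 3) \<le> bound1 (k + 3)" "bound1 (k + 1) \<le> bound3 (k + 2)"
    "2 * (bound1 (k + 2) - bound3 (k + 2)) \<le> bound1 (k + 1) - bound1 k"
    "2 * (bound1 (k + 3) - bound3 (k + 3)) \<le> bound1 (k + 2) - bound1 (k + 1)"
    using bound3_le_bound1[of "k + 2"] bound3_le_bound1[of "k + 3"] bound_gap_le_increment[of k]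
      bound_gap_le_increment[of "k + 1"] bound1_le_bound3[of k] assms(4)
    by (simp_all add: eval_nat_numeral)
  have even: "real (stern (2 * m)) \<le> bound1 (k + 3) + slope (k + 4) * real (2 * m)" for m
  proof -
    have "slope (k + 3) * m \<le> 2 * slope (k + 4) * m"
      using slope_Suc_bounds[of "k + 3"] slope_pos[of "k + 3"]
      by (intro mult_right_mono) (auto simp: eval_nat_numeral)
    moreover have "real (stern m) \<le> bound1 (k + 3) + slope (k + 3) * real m"
      using stern_bounds_imp[OF assms(3), of m] by (simp add: eval_nat_numeral)
    ultimately show ?thesis by (simp add: stern_even)
  qed
  have one: "real (stern (4 * m + 1)) \<le> bound1 (k + 4) + slope (k + 4) * real (4 * m + 1)" for m
  proof (cases m rule: nat_mod4_cases)
    case (1 j)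
    have "stern (4 * m + 1) = stern (2 * j) + stern (4 * j + 1)"
      using stern_4m1[of m] 1 by simp
    thus ?thesis using b2(1)[of j] b3(1)[of j] r(1)[of j] rec gaps 1
      by (simp add: algebra_simps del: add_2_eq_Suc')
  next
    case (2 j)
    have e: "2 * m + 1 = 4 * (2 * j) + 3" using 2 by simp
    have "stern (4 * m + 1) = stern (4 * j + 1) + stern (4 * (2 * j) + 3)"
      unfolding stern_4m1[of m] e using 2 by simp
    thus ?thesis using b2(2)[of j] b3(2)[of "2 * j"] r(1)[of j] rec gaps 2 r1
      by (simp add: algebra_simps del: add_2_eq_Suc')
  next
    case (3 j)
    have "stern (4 * m + 1) = stern (4 * j + 3) + stern (4 * (2 * j + 1) + 3)"
      using stern_4m1[of m] 3 by (simp add: algebra_simps del: add_2_eq_Suc')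
    thus ?thesis using b2(3)[of j] b3(2)[of "2 * j + 1"] r(1)[of j] rec gaps 3 r1
      by (simp add: algebra_simps del: add_2_eq_Suc')
  qed
  have three: "real (stern (4 * m + 3)) \<le> bound3 (k + 4) + slope (k + 4) * real (4 * m + 3)" for m
  proof (cases "m + 1" rule: nat_mod4_cases)
    case (1 j)
    then obtain i where i: "j = i + 1" "m = 2 * i + 1" by (cases j) auto
    have e: "2 * m + 1 = 4 * i + 3" using i by simp
    have "stern (4 * m + 3) = stern (4 * i + 3) + stern (2 * (i + 1))"
      unfolding stern_4m3[of m] e using i by simp
    thus ?thesis using b2(1)[of "i + 1"] b3(2)[of i] r(1)[of i] rec gaps i r1
      by (simp add: algebra_simps del: add_2_eq_Suc')
  next
    case (2 j)
    hence m: "m = 4 * j" by simp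
    \<comment> \<open>Direct estimates at \<open>8 * j + 1\<close> and \<open>4 * j + 1\<close>
      would give \<open>bound1 (k + 2)\<close> where only \<open>bound3 (k + 2)\<close> is allowed.
      Splitting \<open>8 * j + 1\<close> again exposes the even argument \<open>2 * j\<close> with
      its smaller constant; hence the hypothesis at index \<open>k\<close>.\<close>
    have "stern (4 * m + 3) = stern (2 * j) + stern (4 * j + 1) + stern (4 * j + 1)"
      using stern_4m3[of m] stern_4m1[of "2 * j"] m by simp
    thus ?thesis using b1[of j] b2(2)[of j] r[of j] rec gaps m r1
      by (simp add: algebra_simps del: add_2_eq_Suc')
  next
    case (3 j)
    hence m: "m = 4 * j + 2" by simp
    have e: "2 * m + 1 = 4 * (2 * j + 1) + 1" "m + 1 = 4 * j + 3" using m by simp_all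
    have "stern (4 * m + 3) = stern (4 * (2 * j + 1) + 1) + stern (4 * j + 3)"
      unfolding stern_4m3[of m] e ..
    thus ?thesis using b2(3)[of j] b3(1)[of "2 * j + 1"] r(1)[of j] rec gaps m r1
      by (simp add: algebra_simps del: add_2_eq_Suc')
  qed
  show ?thesis
    using even one three by (simp add: stern_bounds_def eval_nat_numeral)
qed

section \<open>Small values and the induction base\<close>

lemma stern_numeral [simp]:
  "stern 0 = 0" "stern 1 = 1" "stern (Suc 0) = 1" "stern (Suc (Suc 0)) = 1"
  "stern (numeral (num.Bit0 k)) = stern (numeral k)"
  "stern (numeral (num.Bit1 k)) = stern (numeral k) + stern (numeral k + 1)"
  using stern_0 stern_1 stern_double[of 1] stern_double[of "numeral k"] stern_double_plus_1[of "numeral k"]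
  by (simp_all add: numeral_Bit0 numeral_Bit1 mult_2 eval_nat_numeral)

lemma stern_le_2: "2 * stern n \<le> n + 1"
proof (induction n rule: less_induct)
  case (less n)
  show ?case
  proof (cases n rule: nat_mod4_cases)
    case (1 m)
    thus ?thesis using less[of m] by (cases "m = 0") (auto simp: stern_even stern_0)
  next
    case (2 m)
    thus ?thesis using less[of m] less[of "2 * m + 1"]
      by (cases "m = 0") (auto simp: stern_4m1[simplified] stern_1)
  next
    case (3 m)
    thus ?thesis using less[of "m + 1"] less[of "2 * m + 1"] stern_4m3[of m] by auto
  qed
qed

text \<open>The recursion yields \<open>3 * m\<close> plus a constant against \<open>4 * m\<close>
  plus a constant, so induction closes above a threshold and the remaining \<open>m\<close> are
  evaluated. Equality holds at 5 and 11.\<close>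

lemma stern_le_3: "3 * stern n \<le> n + 4"
proof (induction n rule: less_induct)
  case (less n)
  show ?case
  proof (cases n rule: nat_mod4_cases)
    case (1 m)
    thus ?thesis using less[of m] by (cases "m = 0") (auto simp: stern_even stern_0)
  next
    case (2 m)
    show ?thesis
    proof (cases "m \<ge> 4")
      case True
      thus ?thesis using less[of m] less[of "2 * m + 1"] 2 stern_4m1[of m] by auto
    next
      case False
      hence "m \<in> {0, 1, 2, 3}" by auto
      thus ?thesis using 2 by auto
    qed
  next
    case (3 m)
    show ?thesis
    proof (cases "m \<ge> 3")
      case True
      thus ?thesis using less[of "m + 1"] less[of "2 * m + 1"] 3 stern_4m3[of m] by auto
    next
      case False
      hence "m \<in> {0, 1, 2}" by auto
      thus ?thesis using 3 by auto
    qed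
  qed
qed

text \<open>Needed because \<open>slope 5\<close> lies between 1/4 and 1/3, so
  \<open>stern_le_3\<close> is too steep there.\<close>

lemma stern_le_4: "4 * stern n \<le> n + 11"
proof (induction n rule: less_induct)
  case (less n)
  show ?case
  proof (cases n rule: nat_mod4_cases)
    case (1 m)
    thus ?thesis using less[of m] by (cases "m = 0") (auto simp: stern_even stern_0)
  next
    case (2 m)
    show ?thesis
    proof (cases "m \<ge> 11")
      case True
      thus ?thesis using less[of m] less[of "2 * m + 1"] 2 stern_4m1[of m] by auto
    next
      case False
      hence "m \<in> {0, 1, 2, 3, 4, 5, 6, 7, 8, 9, 10}" unfolding insert_iff empty_iff by presburger
      thus ?thesis using 2 by auto
    qed
  next
    case (3 m)
    show ?thesis
    proof (cases "m \<ge> 10")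
      case True
      thus ?thesis using less[of "m + 1"] less[of "2 * m + 1"] 3 stern_4m3[of m] by auto
    next
      case False
      hence "m \<in> {0, 1, 2, 3, 4, 5, 6, 7, 8, 9}" unfolding insert_iff empty_iff by presburger
      thus ?thesis using 3 by auto
    qed
  qed
qed

lemma stern_bounds_base: "stern_bounds 2" "stern_bounds 3" "stern_bounds 4"
proof -
  have even: "real (stern (2 * m)) \<le> bound1 k + slope (k + 1) * real (2 * m)"
    if "bound1 k \<ge> 0" "slope (k + 1) \<ge> 1 / 4" "bound1 k + 2 * slope (k + 1) \<ge> 1" for k m
  proof (cases "m = 0")
    case True
    thus ?thesis using that by (simp add: stern_0)
  next
    case False
    have "2 * real (stern m) \<le> real m + 1"
      using stern_le_2[of m] by linarith
    moreover have "(1 / 4) * (2 * (real m - 1)) \<le> slope (k + 1) * (2 * (real m - 1))"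
      using that False by (intro mult_right_mono) auto
    ultimately show ?thesis using that by (simp add: stern_even right_diff_distrib)
  qed
  \<comment> \<open>A line of slope at least \<open>1 / q\<close> need only be compared with the
    elementary bound at the left end \<open>l\<close>.\<close>
  have line: "real (stern n) \<le> b + c * real n"
    if "q * stern n \<le> n + p" "n \<ge> l" "b + c * l \<ge> (l + p) / q" "c \<ge> 1 / q" "q > 0"
    for n l p q :: nat and b c :: real
  proof -
    have "real q * real (stern n) \<le> real n + real p"
      using that(1) by (metis of_nat_add of_nat_le_iff of_nat_mult)
    hence "real (stern n) \<le> (real n + real p) / q"
      using that(5) by (simp add: field_simps)
    also have "\<dots> = (l + p) / q + 1 / q * (real n - real l)"
      using that(5) by (simp add: field_simps)
    also have "\<dots> \<le> (b + c * l) + c * (real n - real l)"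
      using that by (intro add_mono mult_right_mono) auto
    finally show ?thesis by (simp add: algebra_simps)
  qed
  show "stern_bounds 2"
    unfolding stern_bounds_def
  proof (intro conjI allI)
    show "real (stern (2 * m)) \<le> bound1 2 + slope (2 + 1) * real (2 * m)" for m
      by (rule even) (use slope_bounds bound_values in auto)
    show "real (stern (4 * m + 1)) \<le> bound1 (2 + 1) + slope (2 + 1) * real (4 * m + 1)" for m
    proof (cases "m \<ge> 1")
      case True
      show ?thesis
        by (rule line[OF stern_le_3, where l = 5]) (use slope_bounds bound_values True in auto)
    next
      case False
      hence "m = 0" by simp
      thus ?thesis using slope_bounds bound_values by auto
    qed
    show "real (stern (4 * m + 3)) \<le> bound3 (2 + 1) + slope (2 + 1) * real (4 * m + 3)" for m
    proof (cases "m \<ge> 1")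
      case True
      show ?thesis
        by (rule line[OF stern_le_3, where l = 7]) (use slope_bounds bound_values True in auto)
    next
      case False
      hence "m = 0" by simp
      thus ?thesis using slope_bounds bound_values by auto
    qed
  qed
  show "stern_bounds 3"
    unfolding stern_bounds_def
  proof (intro conjI allI)
    show "real (stern (2 * m)) \<le> bound1 3 + slope (3 + 1) * real (2 * m)" for m
      by (rule even) (use slope_bounds bound_values in auto)
    show "real (stern (4 * m + 1)) \<le> bound1 (3 + 1) + slope (3 + 1) * real (4 * m + 1)" for m
    proof (cases "m \<ge> 1")
      case True
      show ?thesis
        by (rule line[OF stern_le_3, where l = 5]) (use slope_bounds bound_values True in auto)
    next
      case False
      hence "m = 0" by simp
      thus ?thesis using slope_bounds bound_values by auto
    qed
    show "real (stern (4 * m + 3)) \<le> bound3 (3 + 1) + slope (3 + 1) * real (4 * m + 3)" for m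
    proof (cases "m \<ge> 2")
      case True
      show ?thesis
        by (rule line[OF stern_le_3, where l = 11]) (use slope_bounds bound_values True in auto)
    next
      case False
      hence "m \<in> {0, 1}" by auto
      thus ?thesis using slope_bounds bound_values by auto
    qed
  qed
  show "stern_bounds 4"
    unfolding stern_bounds_def
  proof (intro conjI allI)
    show "real (stern (2 * m)) \<le> bound1 4 + slope (4 + 1) * real (2 * m)" for m
      by (rule even) (use slope_bounds bound_values in auto)
    show "real (stern (4 * m + 1)) \<le> bound1 (4 + 1) + slope (4 + 1) * real (4 * m + 1)" for m
    proof (cases "m \<ge> 5")
      case True
      show ?thesis
        \<comment> \<open>Both lines take the value 8 at 21, so there is no slack here.\<close>
        by (rule line[OF stern_le_4, where l = 21]) (use slope_bounds bound_values True in auto)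
    next
      case False
      hence "m \<in> {0, 1, 2, 3, 4}" by auto
      thus ?thesis using slope_bounds bound_values by auto
    qed
    show "real (stern (4 * m + 3)) \<le> bound3 (4 + 1) + slope (4 + 1) * real (4 * m + 3)" for m
    proof (cases "m \<ge> 6")
      case True
      show ?thesis
        by (rule line[OF stern_le_4, where l = 27]) (use slope_bounds bound_values True in auto)
    next
      case False
      hence "m \<in> {0, 1, 2, 3, 4, 5}" by auto
      thus ?thesis using slope_bounds bound_values by auto
    qed
  qed
qed

lemma stern_bounds: "stern_bounds k" if "k \<ge> 2"
proof -
  have "stern_bounds (j + 2) \<and> stern_bounds (j + 3) \<and> stern_bounds (j + 4)" for j
  proof (induction j)
    case 0
    show ?case using stern_bounds_base by (simp del: add_2_eq_Suc')
  next
    case (Suc j)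
    moreover have "Suc j + 2 = j + 3" "Suc j + 3 = j + 4" "Suc j + 4 = j + 2 + 3"
      "j + 2 + 1 = j + 3" "j + 2 + 2 = j + 4" by simp_all
    ultimately show ?case using stern_bounds_step[of "j + 2"] by (metis le_add2)
  qed
  from this[of "k - 2"] that show ?thesis by (simp del: add_2_eq_Suc')
qed

section \<open>From chords to the power function\<close>

text \<open>The exponent lies between 0 and 1, so the power is concave; it is 1 at 1 and
  \<open>\<phi>\<close> at 2.\<close>

lemma powr_ge_chord: "1 + (\<phi> - 1) * (t - 1) \<le> t powr log 2 \<phi>" if "1 \<le> t" "t \<le> 2"
proof -
  define a where "a = log 2 \<phi>"
  have a: "0 < a" "a < 1"
    using golden_ratio_bounds by (auto simp: a_def)
  have "concave_on {1..2} (\<lambda>x::real. x powr a)"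
  proof (rule f''_le0_imp_concave)
    fix x :: real assume x: "x \<in> {1..2}"
    show "((\<lambda>x. x powr a) has_real_derivative a * x powr (a - 1)) (at x)"
      using x by (auto intro!: derivative_eq_intros)
    show "((\<lambda>x. a * x powr (a - 1)) has_real_derivative a * ((a - 1) * x powr (a - 1 - 1))) (at x)"
      using x by (auto intro!: derivative_eq_intros)
    show "a * ((a - 1) * x powr (a - 1 - 1)) \<le> 0"
      using a by (intro mult_nonneg_nonpos mult_nonpos_nonneg) auto
  qed auto
  from concave_onD_Icc'[OF this, of t] that show ?thesis
    using golden_ratio_bounds by (simp add: a_def)
qed

text \<open>Normalised so that \<open>stern_limit * x powr log 2 \<phi>\<close> is
  \<open>\<phi> ^ k / sqrt 5\<close> at \<open>x = 2 ^ k / 3\<close>.\<close>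

definition stern_limit :: real where "stern_limit = \<phi> powr log 2 3 / sqrt 5"

lemma two_powr_log: "2 powr log 2 \<phi> = \<phi>"
  using golden_ratio_bounds by simp

lemma three_powr_log: "3 powr log 2 \<phi> = \<phi> powr log 2 3"
  using golden_ratio_bounds by (simp add: powr_def log_def)

lemma power_powr_log: "(2 ^ k) powr log 2 \<phi> = \<phi> ^ k"
  using golden_ratio_bounds
  by (metis powr_realpow two_powr_log zero_less_numeral powr_powr powr_powr_swap
      golden_ratio_gt_1 less_trans zero_less_one)

text \<open>On the interval of the \<open>k\<close>-th chord, the constant \<open>bound1 k\<close>
  exceeds the intercept of the chord by at most \<open>slope k / 3\<close>, which is at most 1, and
  the chord lies below the curve.\<close>

lemma stern_upper_bound:
  assumes "n \<ge> 2"
  shows "real (stern n) \<le> stern_limit * real n powr log 2 \<phi> + 1"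
proof -
  obtain k where "2 ^ k \<le> 3 * n" "3 * n < 2 ^ (k + 1)"
    using ex_power_ivl1[of 2 "3 * n"] assms by auto
  hence k_real: "2 ^ k \<le> 3 * real n" "3 * real n < 2 * 2 ^ k"
    using of_nat_mono[of "2 ^ k" "3 * n", where 'a = real]
      of_nat_less_iff[of "3 * n" "2 ^ (k + 1)", where 'a = real] by simp_all
  have k: "k \<ge> 2"
  proof (rule ccontr)
    assume "\<not> ?thesis"
    hence "2 ^ (k + 1) \<le> (2 :: nat) ^ 2" by (intro power_increasing) auto
    thus False using \<open>3 * n < 2 ^ (k + 1)\<close> assms by simp
  qed
  define t where "t = 3 * real n / 2 ^ k"
  have t: "1 \<le> t" "t \<le> 2"
    using k_real by (auto simp: t_def field_simps)
  have n: "real n = 2 ^ k * (t / 3)"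
    by (simp add: t_def)
  have "stern_limit * real n powr log 2 \<phi> = \<phi> ^ k * t powr log 2 \<phi> / sqrt 5"
    using t golden_ratio_bounds
    by (simp add: n powr_mult powr_divide power_powr_log stern_limit_def three_powr_log)
  moreover have "\<phi> ^ k * (1 + (\<phi> - 1) * (t - 1)) / sqrt 5 \<le> \<phi> ^ k * t powr log 2 \<phi> / sqrt 5"
    using powr_ge_chord[OF t] golden_ratio_bounds by (intro divide_right_mono mult_left_mono) auto
  moreover have "real (stern n) \<le> bound1 k + slope k * real n"
  \<comment> \<open>\<open>stern_bounds\<close> is used at \<open>k - 1\<close>, which must be at
    least 2.\<close>
  proof (cases "k = 2")
    case True
    have "2 * real (stern n) \<le> real n + 1"
      using stern_le_2[of n] by linarith
    moreover have "slope 2 * 1 + 1 / 2 * (real n - 1) \<le> slope 2 * 1 + slope 2 * (real n - 1)"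
      using assms slope_bounds by (intro add_mono mult_right_mono) auto
    ultimately show ?thesis
      using True by (simp add: bound_values right_diff_distrib)
  next
    case False
    thus ?thesis
      using stern_bounds_imp[of "k - 1" n] stern_bounds[of "k - 1"] k by simp
  qed
  moreover have "bound1 k + slope k * real n \<le> \<phi> ^ k * (1 + (\<phi> - 1) * (t - 1)) / sqrt 5 + slope k / 3"
  proof -
    have "bound1 k \<le> ((\<phi> - 1)\<^sup>2 * \<phi> ^ k) / sqrt 5 + slope k / 3"
      using golden_ratio_bounds by (simp add: bound1_def slope_def field_simps)
    moreover have "slope k * real n = \<phi> ^ k * ((\<phi> - 1) * t) / sqrt 5"
      by (simp add: slope_def n power_divide field_simps)
    moreover have "(\<phi> - 1)\<^sup>2 * \<phi> ^ k / sqrt 5 + \<phi> ^ k * ((\<phi> - 1) * t) / sqrt 5 =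
      \<phi> ^ k * (1 + (\<phi> - 1) * (t - 1)) / sqrt 5"
      using golden_ratio_sq by (simp add: power2_eq_square algebra_simps flip: add_divide_distrib)
    ultimately show ?thesis by linarith
  qed
  moreover have "slope k \<le> 3"
    using slope_antimono[OF k] slope_bounds by simp
  ultimately show ?thesis by linarith
qed

section \<open>Sharpness along Jacobsthal numbers\<close>

text \<open>The Jacobsthal numbers of even index: 0, 1, 5, 21, and so on.\<close>

fun stern_arg :: "nat \<Rightarrow> nat" where
  "stern_arg 0 = 0"
| "stern_arg (Suc j) = 4 * stern_arg j + 1"

lemma stern_arg_eq: "real (stern_arg j) = (4 ^ j - 1) / 3"
  by (induction j) auto

text \<open>Binet's formula for the Fibonacci numbers of index \<open>2 * j\<close> and
  \<open>2 * j + 1\<close>. The argument \<open>2 * stern_arg j + 1\<close> is the Jacobsthal number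
  of odd index; the pair is closed under the two recursions.\<close>

lemma stern_stern_arg:
  "real (stern (stern_arg j)) = (\<phi> ^ (2 * j) - (\<phi> - 1) ^ (2 * j)) / sqrt 5 \<and>
   real (stern (2 * stern_arg j + 1)) = (\<phi> * \<phi> ^ (2 * j) + (\<phi> - 1) * (\<phi> - 1) ^ (2 * j)) / sqrt 5"
proof (induction j)
  case 0
  show ?case using sqrt5_bounds by (simp add: sqrt5_eq[symmetric])
next
  case (Suc j)
  let ?m = "stern_arg j"
  have 1: "real (stern (stern_arg (Suc j))) = real (stern ?m) + real (stern (2 * ?m + 1))"
    using stern_4m1[of ?m] by simp
  have "2 * stern_arg (Suc j) + 1 = 4 * (2 * ?m) + 3" by simp
  hence 2: "real (stern (2 * stern_arg (Suc j) + 1)) =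
    real (stern (stern_arg (Suc j))) + real (stern (2 * ?m + 1))"
    using stern_4m3[of "2 * ?m"] by (simp only: stern_arg.simps) simp
  have p: "x ^ (2 * Suc j) = x * x * x ^ (2 * j)" for x :: real by simp
  have 3: "\<phi> * \<phi> * P - (\<phi> - 1) * (\<phi> - 1) * Q = (P - Q) + (\<phi> * P + (\<phi> - 1) * Q)" for P Q :: real
    using golden_ratio_sq by algebra
  have 4: "\<phi> * (\<phi> * \<phi> * P) + (\<phi> - 1) * ((\<phi> - 1) * (\<phi> - 1) * Q) =
    (\<phi> * \<phi> * P - (\<phi> - 1) * (\<phi> - 1) * Q) + (\<phi> * P + (\<phi> - 1) * Q)" for P Q :: real
    using golden_ratio_sq by algebra
  show ?case
    unfolding 2 unfolding 1 p 4 3 using Suc by (simp add: add_divide_distrib diff_divide_distrib)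
qed

lemma stern_lower_limit:
  "(\<lambda>j. real (stern (stern_arg j)) / real (stern_arg j) powr log 2 \<phi>) \<longlonglongrightarrow> stern_limit"
proof -
  define r where "r = (\<phi> - 1)\<^sup>2 / \<phi>\<^sup>2"
  have r: "0 \<le> r" "r < 1"
    using golden_ratio_bounds by (auto simp: r_def field_simps golden_ratio_powers)
  define f where "f j = stern_limit * (1 - r ^ j) / (1 - (1 / 4) ^ j) powr log 2 \<phi>" for j :: nat
  have "f \<longlonglongrightarrow> stern_limit * (1 - 0) / (1 - 0) powr log 2 \<phi>"
    unfolding f_def
    by (intro tendsto_intros LIMSEQ_power_zero) (use r in auto)
  \<comment> \<open>At \<open>j = 0\<close> both numerators vanish, so both quotients are 0.\<close>
  moreover have "real (stern (stern_arg j)) / real (stern_arg j) powr log 2 \<phi> = f j" for j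
  proof -
    have q: "0 \<le> (1 - (1 / 4) ^ j :: real)" by (simp add: power_le_one)
    have "real (stern_arg j) = 2 ^ (2 * j) * (1 - (1 / 4) ^ j) / 3"
      by (simp add: stern_arg_eq power_mult power_divide right_diff_distrib)
    hence "real (stern_arg j) powr log 2 \<phi> =
      \<phi> ^ (2 * j) * (1 - (1 / 4) ^ j) powr log 2 \<phi> / \<phi> powr log 2 3"
      using q by (simp only: powr_mult powr_divide power_powr_log three_powr_log
        zero_le_power zero_le_numeral mult_nonneg_nonneg)
    moreover have "real (stern (stern_arg j)) = \<phi> ^ (2 * j) * (1 - r ^ j) / sqrt 5"
      using stern_stern_arg[of j] golden_ratio_bounds
      by (simp add: r_def power_divide right_diff_distrib flip: power_mult)
    ultimately show ?thesis
      using golden_ratio_bounds by (simp add: f_def stern_limit_def)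
  qed
  ultimately show ?thesis by simp
qed

theorem theorem1:
  "limsup (\<lambda>n. ereal (real (stern n) / real n powr log 2 golden_ratio))
     = ereal (golden_ratio / sqrt 5 * (3 / 2) powr log 2 golden_ratio)
   \<and> golden_ratio / sqrt 5 * (3 / 2) powr log 2 golden_ratio
     = golden_ratio powr log 2 3 / sqrt 5"
proof -
  have eq: "golden_ratio / sqrt 5 * (3 / 2) powr log 2 golden_ratio = stern_limit"
    using golden_ratio_bounds
    by (simp add: powr_divide two_powr_log three_powr_log stern_limit_def)
  let ?a = "\<lambda>n. real (stern n) / real n powr log 2 golden_ratio"
  have pos: "log 2 \<phi> > 0" using golden_ratio_bounds by simp
  \<comment> \<open>The bounded error vanishes after division by a positive power of
    \<open>n\<close>.\<close>
  have "limsup (\<lambda>n. ereal (?a n)) \<le> limsup (\<lambda>n. ereal (stern_limit + 1 / real n powr log 2 \<phi>))"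
  proof (intro Limsup_mono eventually_mono[OF eventually_ge_at_top[of 2]])
    fix n :: nat assume n: "n \<ge> 2"
    show "ereal (?a n) \<le> ereal (stern_limit + 1 / real n powr log 2 \<phi>)"
      using stern_upper_bound[OF n] n by (simp add: field_simps)
  qed
  also have "\<dots> = ereal stern_limit"
  proof (intro lim_imp_Limsup tendsto_ereal)
    have "(\<lambda>n. 1 / real n powr log 2 \<phi>) \<longlonglongrightarrow> 0"
      using pos tendsto_neg_powr[OF _ filterlim_real_sequentially, of "- log 2 \<phi>"]
      by (simp add: powr_minus_divide)
    from tendsto_add[OF tendsto_const this]
    show "(\<lambda>n. stern_limit + 1 / real n powr log 2 \<phi>) \<longlonglongrightarrow> stern_limit" by simp
  qed auto
  finally have upper: "limsup (\<lambda>n. ereal (?a n)) \<le> ereal stern_limit" .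
  have "strict_mono stern_arg"
    by (rule strict_mono_Suc_iff[THEN iffD2]) auto
  from limsup_subseq_mono[OF this, of "\<lambda>n. ereal (?a n)"]
  have "limsup (\<lambda>j. ereal (?a (stern_arg j))) \<le> limsup (\<lambda>n. ereal (?a n))"
    by (simp add: comp_def)
  moreover have "limsup (\<lambda>j. ereal (?a (stern_arg j))) = ereal stern_limit"
    by (intro lim_imp_Limsup tendsto_ereal stern_lower_limit) auto
  ultimately have "limsup (\<lambda>n. ereal (?a n)) = ereal stern_limit"
    using upper by (intro antisym) auto
  thus ?thesis using eq by (simp add: stern_limit_def)
qed

end
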